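(* Let $p$ be a prime, let $n,m$ be positive integers, and let $A=(A_{ij})_{1\le i,j\le n}\in\mathbb{F}_p^{nm\times nm}$ with blocks $A_{ij}\in\mathbb{F}_p^{m\times m}$. Put $A_1=\sum_{j=1}^n A_{1j}$. Consider the network $x(t+1)=Ax(t)$ over $\mathbb{F}_p$. Suppose that the synchronization set $\mathbb{S}=\{\mathbf{1}_n\otimes\alpha \mid \alpha\in\mathbb{F}_p^m\}$ is $A$-invariant, i.e. $A\mathbb{S}\subseteq\mathbb{S}$. Then the network achieves synchronization if and only if $P_A(\lambda)=\lambda^{nm-m}P_{A_1}(\lambda)$.
   Context: $\mathbb{F}_p$ is the finite field with $p$ elements ($p$ prime), $\mathbf{1}_n$ is the $n$-dimensional all-ones column vector, and $\otimes$ is the Kronecker product. $P_M(\lambda)$ denotes the characteristic polynomial of a square matrix $M$. The state is $x(t)=[x_1^{\mathrm T}(t),\dots,x_n^{\mathrm T}(t)]^{\mathrm T}\in\mathbb{F}_p^{nm}$ with $x_i(t)\in\mathbb{F}_p^m$ the state of agent $i$, $t=0,1,2,\dots$. The network $x(t+1)=Ax(t)$ is said to achieve synchronization if for any initial state $x(0)\in\mathbb{F}_p^{nm}$ there exists a finite time $T\in\mathbb{N}$ (positive integers) such that $x_1(t)=x_2(t)=\cdots=x_n(t)$ for all $t\ge T$. *)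

theory Defs
  imports "Jordan_Normal_Form.Char_Poly" "Berlekamp_Zassenhaus.Finite_Field"
begin

text \<open>The field with p elements is the type \<open>'p mod_ring\<close> with \<open>'p :: prime_card\<close> and
  p = CARD('p). Agents and coordinates are numbered from 0, so agent 1 of the network is
  agent 0 here, and coordinate k of agent i is entry i * m + k of the stacked vector.\<close>

definition kronecker_vec :: "'a :: semiring_0 vec \<Rightarrow> 'a vec \<Rightarrow> 'a vec" where
  "kronecker_vec u v =
     vec (dim_vec u * dim_vec v) (\<lambda>i. u $ (i div dim_vec v) * v $ (i mod dim_vec v))"

definition all_ones_vec :: "nat \<Rightarrow> 'a :: one vec" where
  "all_ones_vec n = vec n (\<lambda>_. 1)"

definition sync_set :: "nat \<Rightarrow> nat \<Rightarrow> 'a :: semiring_1 vec set" where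
  "sync_set n m = {kronecker_vec (all_ones_vec n) \<alpha> | \<alpha>. \<alpha> \<in> carrier_vec m}"

definition block :: "nat \<Rightarrow> 'a mat \<Rightarrow> nat \<Rightarrow> nat \<Rightarrow> 'a mat" where
  "block m A i j = mat m m (\<lambda>(k, l). A $$ (i * m + k, j * m + l))"

text \<open>The sum of the blocks in the first block row. It is written entrywise because matrices
  of unspecified dimension have no neutral element for addition.\<close>

definition first_block_row_sum :: "nat \<Rightarrow> nat \<Rightarrow> 'a :: comm_monoid_add mat \<Rightarrow> 'a mat" where
  "first_block_row_sum n m A = mat m m (\<lambda>(k, l). \<Sum>j<n. block m A 0 j $$ (k, l))"

definition agent_state :: "nat \<Rightarrow> 'a vec \<Rightarrow> nat \<Rightarrow> 'a vec" where
  "agent_state m x i = vec m (\<lambda>k. x $ (i * m + k))"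

definition trajectory :: "'a :: semiring_0 mat \<Rightarrow> (nat \<Rightarrow> 'a vec) \<Rightarrow> bool" where
  "trajectory A x \<longleftrightarrow> (\<forall>t. x (Suc t) = A *\<^sub>v x t)"

definition achieves_synchronization :: "nat \<Rightarrow> nat \<Rightarrow> 'a :: semiring_0 mat \<Rightarrow> bool" where
  "achieves_synchronization n m A \<longleftrightarrow>
     (\<forall>x. x 0 \<in> carrier_vec (n * m) \<and> trajectory A x \<longrightarrow>
        (\<exists>T>0. \<forall>t\<ge>T. \<forall>i<n. \<forall>j<n. agent_state m (x t) i = agent_state m (x t) j))"

end

theory Submission
  imports Defs
begin

text \<open>The idea is to separate the state of the first agent from the deviations of the other agents
from it. Write \<open>r = n * m - m\<close> and cut the matrix into blocks \<open>a\<close>, \<open>b\<close>, \<open>c\<close>, \<open>d\<close> after the first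
\<open>m\<close> rows and columns. A synchronized state is \<open>v\<close> followed by \<open>L v\<close>, where \<open>L\<close> stacks \<open>n - 1\<close>
identity matrices; so the synchronization set is the graph of \<open>L\<close>, and its invariance is the matrix
identity \<open>c + d L = L (a + b L)\<close> (lemma \<open>sync_set_invariant_blocks\<close>). Every state has the form
\<open>(v, L v + w)\<close>, and the agents agree exactly when the deviation \<open>w\<close> vanishes. In the coordinates
\<open>(v, w)\<close> the invariance makes the system block triangular, with diagonal blocks \<open>a + b L\<close>, which is
the sum of the first block row, and \<open>D = d - L b\<close>. Two consequences follow.

On the one hand the deviations evolve autonomously by \<open>D\<close>, so the network synchronizes if and only
if every vector is eventually killed by the powers of \<open>D\<close>, that is, if and only if \<open>D\<close> is nilpotent.
On the other hand the characteristic polynomial of the network is the product of those of the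
row sum and of \<open>D\<close>; since the former is nonzero it can be cancelled, and the polynomial condition
of the theorem says that the characteristic polynomial of \<open>D\<close> is the monomial of degree \<open>r\<close>.

It remains that a matrix is nilpotent if and only if its characteristic polynomial is a power of
the variable. Eigenvalues in the given field cannot decide this, because the field is not
algebraically closed; both directions are instead read off from identities for the polynomial
matrix \<open>X I - D\<close> (lemmas \<open>char_poly_nilpotent\<close> and \<open>nilpotent_if_char_poly_monom\<close>).\<close>

section \<open>Nilpotent matrices and their characteristic polynomials\<close>

lemma factor_of_monom:
  fixes p q :: "'a :: idom poly"
  assumes "p * q = Polynomial.monom 1 j"
  shows "\<exists>c i. p = Polynomial.monom c i"
  using assms
proof (induction j arbitrary: p q)
  case 0
  then have pq: "p * q = 1" by (simp add: Polynomial.monom_0)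
  then have "p dvd 1" by (metis dvd_triv_left)
  then obtain c where "p = [:c:]" using is_unit_polyE by blast
  then show ?case by (metis Polynomial.monom_0)
next
  case (Suc j)
  have shift: "Polynomial.monom 1 (Suc j) = pCons 0 (Polynomial.monom (1::'a) j)"
    by (simp add: Polynomial.monom_Suc)
  have "poly.coeff p 0 * poly.coeff q 0 = 0"
    using arg_cong[OF Suc.prems, of "\<lambda>u. poly.coeff u 0"] by (simp add: coeff_mult_0)
  then consider "poly.coeff p 0 = 0" | "poly.coeff q 0 = 0" by auto
  then show ?case
  proof cases
    case 1
    then obtain p' where p: "p = pCons 0 p'" by (metis coeff_pCons_0 pCons_cases)
    then have "p' * q = Polynomial.monom 1 j" using Suc.prems shift by simp
    then show ?thesis using Suc.IH p by (metis Polynomial.monom_Suc)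
  next
    case 2
    then obtain q' where q: "q = pCons 0 q'" by (metis coeff_pCons_0 pCons_cases)
    then have "p * q' = Polynomial.monom 1 j" using Suc.prems shift by simp
    then show ?thesis by (rule Suc.IH)
  qed
qed

lemma pow_mat_add:
  fixes D :: "'a :: semiring_1 mat"
  assumes D: "D \<in> carrier_mat N N"
  shows "D ^\<^sub>m (s + t) = D ^\<^sub>m s * D ^\<^sub>m t"
proof (induction t)
  case 0
  then show ?case using right_mult_one_mat[OF pow_carrier_mat[OF D]] D by simp
next
  case (Suc t)
  then show ?case
    using assoc_mult_mat[OF pow_carrier_mat[OF D, of s] pow_carrier_mat[OF D, of t] D] by simp
qed

definition const_mat :: "'a :: comm_ring_1 mat \<Rightarrow> 'a poly mat" where
  "const_mat = map_mat (\<lambda>a. [:a:])"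

lemma const_mat_carrier [simp]:
  "const_mat D \<in> carrier_mat nr nc \<longleftrightarrow> D \<in> carrier_mat nr nc"
  unfolding const_mat_def by (rule map_carrier_mat)

text \<open>This is the factorization of \<open>X^k - D^k\<close> with the factor \<open>X - D\<close> for matrices; the cofactor is
built by the recursion \<open>Q' = X Q + D^k\<close>, which avoids writing it as a sum.\<close>

lemma power_minus_const_pow_factor:
  fixes D :: "'a :: comm_ring_1 mat"
  assumes D: "D \<in> carrier_mat N N"
  shows "\<exists>Q \<in> carrier_mat N N.
    Q * char_poly_matrix D = Polynomial.monom 1 k \<cdot>\<^sub>m 1\<^sub>m N - const_mat (D ^\<^sub>m k)"
proof (induction k)
  case 0
  have "0\<^sub>m N N * char_poly_matrix D = Polynomial.monom 1 0 \<cdot>\<^sub>m 1\<^sub>m N - const_mat (D ^\<^sub>m 0)"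
    using D by (intro eq_matI) (auto simp: const_mat_def Polynomial.monom_0 char_poly_matrix_def)
  then show ?case by (rule bexI) simp
next
  case (Suc k)
  then obtain Q where Q: "Q \<in> carrier_mat N N"
    and eq: "Q * char_poly_matrix D = Polynomial.monom 1 k \<cdot>\<^sub>m 1\<^sub>m N - const_mat (D ^\<^sub>m k)" by auto
  let ?X = "[:0, 1:] :: 'a poly"
  let ?M = "char_poly_matrix D"
  let ?C = "const_mat (D ^\<^sub>m k)"
  have C: "?C \<in> carrier_mat N N" and cD: "const_mat D \<in> carrier_mat N N" and M: "?M \<in> carrier_mat N N" using D by auto
  have Mdef: "?M = ?X \<cdot>\<^sub>m 1\<^sub>m N - const_mat D"
    using D by (intro eq_matI) (auto simp: char_poly_matrix_def const_mat_def)
  have "?C * ?M = ?X \<cdot>\<^sub>m ?C - ?C * const_mat D"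
    unfolding Mdef using C cD mult_smult_distrib[OF C one_carrier_mat, of ?X] right_mult_one_mat[OF C]
    by (subst mult_minus_distrib_mat[OF C _ cD]) simp_all
  also have "?C * const_mat D = const_mat (D ^\<^sub>m Suc k)"
    using map_poly_mult(1)[OF pow_carrier_mat[OF D, of k] D] by (simp add: const_mat_def)
  finally have step: "?C * ?M = ?X \<cdot>\<^sub>m ?C - const_mat (D ^\<^sub>m Suc k)" .
  have "(?X \<cdot>\<^sub>m Q + ?C) * ?M = ?X \<cdot>\<^sub>m (Q * ?M) + ?C * ?M"
    using Q C M by (simp add: add_mult_distrib_mat[of _ N N] mult_smult_assoc_mat[of _ N N])
  also have "\<dots> = Polynomial.monom 1 (Suc k) \<cdot>\<^sub>m 1\<^sub>m N - const_mat (D ^\<^sub>m Suc k)"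
    unfolding eq step using D
    by (intro eq_matI)
      (simp_all add: const_mat_def Polynomial.monom_Suc smult_add_right smult_diff_right del: pow_mat.simps)
  finally show ?case by (rule bexI) (use Q C in auto)
qed

text \<open>If \<open>D^k = 0\<close>, then \<open>X I - D\<close> is a factor of \<open>X^k I\<close>. Taking determinants, the characteristic
polynomial divides a power of \<open>X\<close>, and being monic of degree \<open>N\<close> it must be \<open>X^N\<close>.\<close>

lemma char_poly_nilpotent:
  fixes D :: "'a :: idom mat"
  assumes D: "D \<in> carrier_mat N N" and nil: "D ^\<^sub>m k = 0\<^sub>m N N"
  shows "char_poly D = Polynomial.monom 1 N"
proof -
  obtain Q where Q: "Q \<in> carrier_mat N N"
    and eq: "Q * char_poly_matrix D = Polynomial.monom 1 k \<cdot>\<^sub>m 1\<^sub>m N - const_mat (D ^\<^sub>m k)"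
    using power_minus_const_pow_factor[OF D] by blast
  have "Q * char_poly_matrix D = Polynomial.monom 1 k \<cdot>\<^sub>m 1\<^sub>m N"
    unfolding eq nil by (intro eq_matI) (auto simp: const_mat_def)
  then have "det Q * char_poly D = det (Polynomial.monom 1 k \<cdot>\<^sub>m 1\<^sub>m N)"
    using det_mult[OF Q char_poly_matrix_closed[OF D]] by (simp add: char_poly_def)
  then have "char_poly D * det Q = Polynomial.monom 1 (k * N)"
    by (simp add: det_smult mult.commute monom_power)
  then obtain c i where ci: "char_poly D = Polynomial.monom c i" using factor_of_monom by blast
  then show ?thesis
    using degree_monic_char_poly[OF D] by (auto simp: degree_monom_eq split: if_splits)
qed

definition coeff_mat :: "'a :: zero poly mat \<Rightarrow> nat \<Rightarrow> 'a mat" where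
  "coeff_mat M k = map_mat (\<lambda>p. poly.coeff p k) M"

text \<open>The Cayley--Hamilton theorem for the polynomial \<open>X^N\<close>. Let \<open>C k\<close> be the matrix of the coefficients
of \<open>X^k\<close> in the adjugate of \<open>X I - D\<close>. Comparing coefficients in
\<open>(X I - D) adj(X I - D) = X^N I\<close> expresses \<open>D C (k + 1)\<close> by \<open>C k\<close>; multiplied with powers of \<open>D\<close>,
these equations telescope to \<open>D^(k+1) C k = - D^N\<close> for all \<open>k \<ge> N\<close>, and the left-hand side
vanishes for large \<open>k\<close>.\<close>

lemma nilpotent_if_char_poly_monom:
  fixes D :: "'a :: comm_ring_1 mat"
  assumes D: "D \<in> carrier_mat N N" and char: "char_poly D = Polynomial.monom 1 N"
  shows "D ^\<^sub>m N = 0\<^sub>m N N"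
proof -
  define R where "R = adj_mat (char_poly_matrix D)"
  define C where "C k = coeff_mat R k" for k
  have M: "char_poly_matrix D \<in> carrier_mat N N" using D by simp
  have R: "R \<in> carrier_mat N N" unfolding R_def by (rule adj_mat(1)[OF M])
  have C: "C k \<in> carrier_mat N N" for k using R by (simp add: C_def coeff_mat_def)
  have prod: "char_poly_matrix D * R = Polynomial.monom 1 N \<cdot>\<^sub>m 1\<^sub>m N"
    unfolding R_def using adj_mat(2)[OF M] char by (simp add: char_poly_def)
  have entry: "[:0, 1:] * R $$ (i, j) - (\<Sum>l = 0..<N. [:D $$ (i, l):] * R $$ (l, j))
      = (if i = j then Polynomial.monom 1 N else 0)" if ij: "i < N" "j < N" for i j
  proof -
    have "(char_poly_matrix D * R) $$ (i, j) = (\<Sum>l = 0..<N. char_poly_matrix D $$ (i, l) * R $$ (l, j))"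
      using ij M R by (simp add: scalar_prod_def)
    also have "\<dots> = (\<Sum>l = 0..<N. (if l = i then [:0, 1:] * R $$ (l, j) else 0) - [:D $$ (i, l):] * R $$ (l, j))"
      using ij D by (intro sum.cong) (auto simp: char_poly_matrix_def algebra_simps)
    also have "\<dots> = [:0, 1:] * R $$ (i, j) - (\<Sum>l = 0..<N. [:D $$ (i, l):] * R $$ (l, j))"
      using ij by (simp add: sum_subtractf)
    finally show ?thesis using prod ij by (simp split: if_splits)
  qed
  have DC: "(D * C k) $$ (i, j) = (\<Sum>l = 0..<N. D $$ (i, l) * poly.coeff (R $$ (l, j)) k)"
    if "i < N" "j < N" for i j k
    using that D R C[of k] by (simp add: scalar_prod_def C_def coeff_mat_def)
  have recur: "(D * C k) $$ (i, j) =
      poly.coeff ([:0, 1:] * R $$ (i, j)) k - (if i = j \<and> k = N then 1 else 0)"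
    if ij: "i < N" "j < N" for i j k
  proof -
    have "(if i = j \<and> k = N then 1 else 0) = poly.coeff (if i = j then Polynomial.monom 1 N else 0 :: 'a poly) k"
      by simp
    also have "\<dots> = poly.coeff ([:0, 1:] * R $$ (i, j)) k - (D * C k) $$ (i, j)"
      unfolding entry[OF ij, symmetric] DC[OF ij] by (simp add: coeff_sum)
    finally show ?thesis by (simp only: algebra_simps)
  qed
  have rec0: "D * C 0 = (if N = 0 then - 1\<^sub>m N else 0\<^sub>m N N)"
    using D C[of 0] recur[of _ _ 0] by (intro eq_matI) (simp_all split: if_splits)
  have recS: "D * C (Suc k) = C k - (if Suc k = N then 1\<^sub>m N else 0\<^sub>m N N)" for k
  proof (rule eq_matI)
    let ?J = "if Suc k = N then 1\<^sub>m N else 0\<^sub>m N N :: 'a mat"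
    have J: "?J \<in> carrier_mat N N" by simp
    fix i j assume "i < dim_row (C k - ?J)" and "j < dim_col (C k - ?J)"
    then have ij: "i < N" "j < N" by (auto split: if_splits)
    then show "(D * C (Suc k)) $$ (i, j) = (C k - ?J) $$ (i, j)"
      unfolding recur[OF ij] using R J by (simp add: C_def coeff_mat_def)
  qed (use D C[of "Suc k"] in auto)
  have tele: "D ^\<^sub>m Suc k * C k = (if k < N then 0\<^sub>m N N else - (D ^\<^sub>m N))" for k
  proof (induction k)
    case 0
    then show ?case using D rec0 by auto
  next
    case (Suc k)
    have P: "D ^\<^sub>m Suc k \<in> carrier_mat N N" using D by (rule pow_carrier_mat)
    have "D ^\<^sub>m Suc (Suc k) * C (Suc k) = D ^\<^sub>m Suc k * (D * C (Suc k))"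
      using assoc_mult_mat[OF P D C] by simp
    also have "\<dots> = D ^\<^sub>m Suc k * C k - D ^\<^sub>m Suc k * (if Suc k = N then 1\<^sub>m N else 0\<^sub>m N N)"
      unfolding recS by (rule mult_minus_distrib_mat[OF P C]) auto
    also have "\<dots> = (if Suc k < N then 0\<^sub>m N N else - (D ^\<^sub>m N))"
    proof (cases "Suc k = N")
      case True
      then show ?thesis
        unfolding Suc.IH using right_mult_one_mat[OF P] P D
        by (intro eq_matI) (auto simp del: pow_mat.simps)
    next
      case False
      then show ?thesis
        unfolding Suc.IH using right_mult_zero_mat[OF P, of N] pow_carrier_mat[OF D, of N] D
        by (intro eq_matI) (auto simp del: pow_mat.simps split: if_splits)
    qed
    finally show ?case .
  qed
  \<comment> \<open>Any index above \<open>N\<close> and all degrees in the adjugate works; a sum serves as such a bound.\<close>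
  obtain K where K: "K \<ge> N" "C K = 0\<^sub>m N N"
  proof -
    define K where "K = N + (\<Sum>i<N. \<Sum>j<N. Suc (degree (R $$ (i, j))))"
    have "poly.coeff (R $$ (i, j)) K = 0" if ij: "i < N" "j < N" for i j
    proof (rule coeff_eq_0)
      have "Suc (degree (R $$ (i, j))) \<le> (\<Sum>j<N. Suc (degree (R $$ (i, j))))"
        using ij by (intro member_le_sum) auto
      also have "\<dots> \<le> (\<Sum>i<N. \<Sum>j<N. Suc (degree (R $$ (i, j))))"
        using ij by (intro member_le_sum[of i _ "\<lambda>i. \<Sum>j<N. Suc (degree (R $$ (i, j)))"]) auto
      finally show "degree (R $$ (i, j)) < K" by (simp add: K_def)
    qed
    then have "C K = 0\<^sub>m N N" using R by (intro eq_matI) (auto simp: C_def coeff_mat_def)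
    moreover have "N \<le> K" by (simp add: K_def)
    ultimately show ?thesis by (rule that[rotated])
  qed
  have neg: "- (D ^\<^sub>m N) = 0\<^sub>m N N"
    using tele[of K] K right_mult_zero_mat[OF pow_carrier_mat[OF D, of "Suc K"], of N]
    by (simp del: pow_mat.simps)
  show ?thesis
  proof (rule eq_matI)
    fix i j assume "i < dim_row (0\<^sub>m N N :: 'a mat)" "j < dim_col (0\<^sub>m N N :: 'a mat)"
    then show "(D ^\<^sub>m N) $$ (i, j) = 0\<^sub>m N N $$ (i, j)"
      using arg_cong[OF neg, of "\<lambda>M. M $$ (i, j)"] D by (auto split: if_splits)
  qed (use D in auto)
qed

text \<open>The times after which the finitely many unit vectors have died have a common upper bound.\<close>

lemma nilpotent_iff_pointwise:
  fixes D :: "'a :: comm_ring_1 mat"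
  assumes D: "D \<in> carrier_mat N N"
  shows "(\<exists>k. D ^\<^sub>m k = 0\<^sub>m N N) \<longleftrightarrow>
    (\<forall>w \<in> carrier_vec N. \<exists>T. \<forall>t\<ge>T. D ^\<^sub>m t *\<^sub>v w = 0\<^sub>v N)" (is "?nil \<longleftrightarrow> ?dies")
proof
  assume ?nil
  then obtain k where k: "D ^\<^sub>m k = 0\<^sub>m N N" ..
  have "D ^\<^sub>m t = 0\<^sub>m N N" if "t \<ge> k" for t
    using pow_mat_add[OF D, of k "t - k"] that k left_mult_zero_mat[OF pow_carrier_mat[OF D]] by simp
  then show ?dies by (auto intro!: exI[of _ k])
next
  assume ?dies
  then have "\<forall>j. \<exists>T. \<forall>t\<ge>T. D ^\<^sub>m t *\<^sub>v unit_vec N j = 0\<^sub>v N" by simp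
  then obtain T where T: "\<And>j t. t \<ge> T j \<Longrightarrow> D ^\<^sub>m t *\<^sub>v unit_vec N j = 0\<^sub>v N" by metis
  define k where "k = (\<Sum>j<N. T j)"
  have "D ^\<^sub>m k = 0\<^sub>m N N"
  proof (rule eq_matI)
    fix i j assume "i < dim_row (0\<^sub>m N N :: 'a mat)" "j < dim_col (0\<^sub>m N N :: 'a mat)"
    then have ij: "i < N" "j < N" by auto
    have "T j \<le> k" unfolding k_def using ij by (intro member_le_sum) auto
    then have "(D ^\<^sub>m k *\<^sub>v unit_vec N j) $ i = 0" using T[of j k] ij by simp
    then show "(D ^\<^sub>m k) $$ (i, j) = 0\<^sub>m N N $$ (i, j)"
      using ij D pow_carrier_mat[OF D, of k] by simp
  qed (use D in auto)
  then show ?nil by blast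
qed

section \<open>Synchronized states as the graph of a linear map\<close>

lemma eq_mat_if_unit_vecs:
  fixes A B :: "'a :: semiring_1 mat"
  assumes A: "A \<in> carrier_mat nr nc" and B: "B \<in> carrier_mat nr nc"
    and eq: "\<And>j. j < nc \<Longrightarrow> A *\<^sub>v unit_vec nc j = B *\<^sub>v unit_vec nc j"
  shows "A = B"
proof (rule eq_matI)
  fix i j assume "i < dim_row B" "j < dim_col B"
  then have ij: "i < nr" "j < nc" using B by auto
  then show "A $$ (i, j) = B $$ (i, j)"
    using arg_cong[OF eq[OF ij(2)], of "\<lambda>v. v $ i"] A B by simp
qed (use A B in auto)

text \<open>Identity matrices of size \<open>m\<close> stacked on top of each other, as many as fit into \<open>r\<close> rows. With
\<open>r = n * m - m\<close> it sends the state of the first agent to that of the other agents when all agree.\<close>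

definition copies_mat :: "nat \<Rightarrow> nat \<Rightarrow> 'a :: zero_neq_one mat" where
  "copies_mat r m = mat r m (\<lambda>(i, j). if j = i mod m then 1 else 0)"

lemma copies_mat_carrier [simp]: "copies_mat r m \<in> carrier_mat r m"
  by (simp add: copies_mat_def)

lemma copies_mat_mult_vec:
  fixes v :: "'a :: semiring_1 vec"
  assumes "v \<in> carrier_vec m" "i < r" "m > 0"
  shows "(copies_mat r m *\<^sub>v v) $ i = v $ (i mod m)"
proof -
  have "(copies_mat r m *\<^sub>v v) $ i = (\<Sum>j = 0..<m. (if j = i mod m then 1 else 0) * v $ j)"
    using assms by (simp add: copies_mat_def scalar_prod_def)
  also have "\<dots> = (\<Sum>j = 0..<m. if j = i mod m then v $ j else 0)"
    by (intro sum.cong) auto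
  finally show ?thesis using assms by simp
qed

lemma sync_vec_eq_append:
  fixes \<alpha> :: "'a :: semiring_1 vec"
  assumes n: "n > 0" and m: "m > 0" and \<alpha>: "\<alpha> \<in> carrier_vec m"
  shows "kronecker_vec (all_ones_vec n) \<alpha> = \<alpha> @\<^sub>v (copies_mat (n * m - m) m *\<^sub>v \<alpha>)"
proof (rule eq_vecI)
  have dim: "m + (n * m - m) = n * m" using n by (cases n) auto
  then show "dim_vec (kronecker_vec (all_ones_vec n) \<alpha>) =
      dim_vec (\<alpha> @\<^sub>v (copies_mat (n * m - m) m *\<^sub>v \<alpha>))"
    using \<alpha> by (simp add: kronecker_vec_def all_ones_vec_def copies_mat_def)
  fix i assume "i < dim_vec (\<alpha> @\<^sub>v (copies_mat (n * m - m) m *\<^sub>v \<alpha>))"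
  then have i: "i < n * m" using \<alpha> dim by (simp add: copies_mat_def)
  then have "i div m < n" by (simp add: less_mult_imp_div_less)
  then have "kronecker_vec (all_ones_vec n) \<alpha> $ i = \<alpha> $ (i mod m)"
    using i \<alpha> by (simp add: kronecker_vec_def all_ones_vec_def)
  also have "\<dots> = (\<alpha> @\<^sub>v (copies_mat (n * m - m) m *\<^sub>v \<alpha>)) $ i"
  proof (cases "i < m")
    case True
    then show ?thesis using \<alpha> by simp
  next
    case False
    moreover have "i - m < n * m - m" using i False by auto
    ultimately show ?thesis
      using \<alpha> m i dim copies_mat_mult_vec[OF \<alpha>, of "i - m" "n * m - m"]
      by (simp add: le_mod_geq copies_mat_def del: index_mult_mat_vec)
  qed
  finally show "kronecker_vec (all_ones_vec n) \<alpha> $ i =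
      (\<alpha> @\<^sub>v (copies_mat (n * m - m) m *\<^sub>v \<alpha>)) $ i" .
qed

text \<open>The summand \<open>w\<close> is the deviation of the other agents from the first one, so it measures the
failure of synchronization.\<close>

lemma agents_agree_iff:
  fixes v w :: "'a :: ring_1 vec"
  assumes m: "m > 0" and v: "v \<in> carrier_vec m" and w: "w \<in> carrier_vec (n * m - m)"
  defines "x \<equiv> v @\<^sub>v (copies_mat (n * m - m) m *\<^sub>v v + w)"
  shows "(\<forall>i<n. \<forall>j<n. agent_state m x i = agent_state m x j) \<longleftrightarrow> w = 0\<^sub>v (n * m - m)"
proof
  let ?r = "n * m - m"
  have head: "x $ k = v $ k" if "k < m" for k
    using that v w by (simp add: x_def copies_mat_def)
  have tail: "x $ (m + i) = v $ (i mod m) + w $ i" if "i < ?r" for i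
    using that v w m copies_mat_mult_vec[OF v that m]
    by (simp add: x_def copies_mat_def del: index_mult_mat_vec)
  {
    assume agree: "\<forall>i<n. \<forall>j<n. agent_state m x i = agent_state m x j"
    show "w = 0\<^sub>v ?r"
    proof (rule eq_vecI)
      fix i assume "i < dim_vec (0\<^sub>v ?r :: 'a vec)"
      then have i: "i < ?r" by simp
      \<comment> \<open>Entry \<open>i\<close> of \<open>w\<close> belongs to agent \<open>i div m + 1\<close>, since \<open>w\<close> skips the first agent.\<close>
      define q where "q = Suc (i div m)"
      have qi: "q * m + i mod m = m + i" by (simp add: q_def)
      have "q * m < n * m"
      proof -
        have "i div m * m \<le> i" by simp
        then show ?thesis using i unfolding q_def mult_Suc by linarith
      qed
      then have q: "q < n" by simp
      then have "0 < n" by simp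
      then have "agent_state m x q $ (i mod m) = agent_state m x 0 $ (i mod m)"
        by (simp only: agree[rule_format, OF q])
      then have "x $ (m + i) = x $ (i mod m)" using m qi by (simp add: agent_state_def)
      then have "v $ (i mod m) + w $ i = v $ (i mod m) + 0"
        unfolding tail[OF i] head[OF mod_less_divisor[OF m]] by (simp only: add_0_right)
      then have "w $ i = 0" by (rule add_left_imp_eq)
      then show "w $ i = 0\<^sub>v ?r $ i" using i by simp
    qed (use w in simp)
  next
    assume w0: "w = 0\<^sub>v ?r"
    have "agent_state m x i = v" if i: "i < n" for i
    proof (rule eq_vecI)
      fix k assume "k < dim_vec v"
      then have k: "k < m" using v by simp
      show "agent_state m x i $ k = v $ k"
      proof (cases i)
        case 0
        then show ?thesis using k head by (simp add: agent_state_def)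
      next
        case (Suc q)
        have "Suc i * m \<le> n * m" using i by (intro mult_le_mono1) simp
        then have "q * m + k < ?r" using k unfolding Suc mult_Suc by linarith
        then show ?thesis using tail[of "q * m + k"] k w0 Suc
          by (simp add: agent_state_def add.assoc)
      qed
    qed (use v in \<open>simp add: agent_state_def\<close>)
    then show "\<forall>i<n. \<forall>j<n. agent_state m x i = agent_state m x j" by simp
  }
qed

text \<open>Multiplying \<open>b\<close> by stacked identities adds up its blocks, which are those of the first block row
except the leading block \<open>a\<close>.\<close>

lemma first_block_row_sum_eq:
  fixes a b c d :: "'a :: semiring_1 mat"
  assumes n: "n > 0" and a: "a \<in> carrier_mat m m" and b: "b \<in> carrier_mat m (n * m - m)"
    and d: "d \<in> carrier_mat (n * m - m) (n * m - m)"
  shows "first_block_row_sum n m (four_block_mat a b c d) = a + b * copies_mat (n * m - m) m"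
proof (rule eq_matI)
  let ?r = "n * m - m" and ?A = "four_block_mat a b c d"
  fix k l assume "k < dim_row (a + b * copies_mat ?r m)" "l < dim_col (a + b * copies_mat ?r m)"
  then have kl: "k < m" "l < m" using b by (auto simp: copies_mat_def)
  obtain n' where n': "n = Suc n'" using n by (cases n) auto
  have r: "?r = n' * m" by (simp add: n')
  have "(b * copies_mat ?r m) $$ (k, l) = (\<Sum>i<n' * m. if l = i mod m then b $$ (k, i) else 0)"
    using kl b unfolding r by (auto simp: copies_mat_def scalar_prod_def lessThan_atLeast0 intro!: sum.cong)
  also have "\<dots> = (\<Sum>q<n'. \<Sum>i\<in>{q * m..<q * m + m}. if l = i mod m then b $$ (k, i) else 0)"
    by (rule sum.nat_group[symmetric])
  also have "\<dots> = (\<Sum>q<n'. b $$ (k, q * m + l))"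
  proof (rule sum.cong[OF refl])
    fix q
    have "(\<Sum>i\<in>{q * m..<q * m + m}. if l = i mod m then b $$ (k, i) else 0)
        = (\<Sum>i\<in>{q * m..<q * m + m}. if i = q * m + l then b $$ (k, i) else 0)"
    proof (rule sum.cong[OF refl])
      fix i assume "i \<in> {q * m..<q * m + m}"
      then obtain e where "i = q * m + e" "e < m"
        by (metis add.commute atLeastLessThan_iff le_Suc_ex nat_add_left_cancel_less)
      then show "(if l = i mod m then b $$ (k, i) else 0) = (if i = q * m + l then b $$ (k, i) else 0)"
        by auto
    qed
    then show "(\<Sum>i\<in>{q * m..<q * m + m}. if l = i mod m then b $$ (k, i) else 0) = b $$ (k, q * m + l)"
      using kl by simp
  qed
  finally have bL: "(b * copies_mat ?r m) $$ (k, l) = (\<Sum>q<n'. b $$ (k, q * m + l))" .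
  have right: "?A $$ (k, Suc q * m + l) = b $$ (k, q * m + l)" if q: "q < n'" for q
  proof -
    have "Suc q * m \<le> n' * m" using q by (intro mult_le_mono1) simp
    then have "q * m + l < n' * m" using kl unfolding mult_Suc by linarith
    then show ?thesis using kl a b d unfolding r by (simp add: add.assoc)
  qed
  have "first_block_row_sum n m ?A $$ (k, l) = (\<Sum>j<n. ?A $$ (k, j * m + l))"
    using kl by (simp add: first_block_row_sum_def block_def)
  also have "\<dots> = ?A $$ (k, l) + (\<Sum>q<n'. ?A $$ (k, Suc q * m + l))"
    unfolding n' sum.lessThan_Suc_shift by simp
  also have "\<dots> = a $$ (k, l) + (\<Sum>q<n'. b $$ (k, q * m + l))"
  proof -
    have "(\<Sum>q<n'. ?A $$ (k, Suc q * m + l)) = (\<Sum>q<n'. b $$ (k, q * m + l))"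
      using right by (intro sum.cong) auto
    moreover have "?A $$ (k, l) = a $$ (k, l)" using kl a d by simp
    ultimately show ?thesis by (simp only:)
  qed
  also have "\<dots> = (a + b * copies_mat ?r m) $$ (k, l)"
    unfolding bL[symmetric] using kl a b by (simp add: copies_mat_def)
  finally show "first_block_row_sum n m ?A $$ (k, l) = (a + b * copies_mat ?r m) $$ (k, l)" .
qed (use b in \<open>auto simp: first_block_row_sum_def copies_mat_def\<close>)

section \<open>Block triangular form along an invariant graph\<close>

text \<open>The change of coordinates from \<open>(v, w)\<close> to \<open>(v, L v + w)\<close>, which carries the subspace \<open>w = 0\<close>
onto the graph of \<open>L\<close>.\<close>

definition shear_mat :: "'a :: {zero, one} mat \<Rightarrow> 'a mat" where
  "shear_mat L = four_block_mat (1\<^sub>m (dim_col L)) (0\<^sub>m (dim_col L) (dim_row L)) L (1\<^sub>m (dim_row L))"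

lemma shear_mat_carrier [simp]:
  "L \<in> carrier_mat r m \<Longrightarrow> shear_mat L \<in> carrier_mat (m + r) (m + r)"
  by (auto simp: shear_mat_def)

lemma shear_mat_inverse:
  fixes L :: "'a :: ring_1 mat"
  assumes L: "L \<in> carrier_mat r m"
  shows "shear_mat L * shear_mat (- L) = 1\<^sub>m (m + r)" "shear_mat (- L) * shear_mat L = 1\<^sub>m (m + r)"
proof -
  have inv: "shear_mat L * shear_mat (- L) = 1\<^sub>m (m + r)" if L: "L \<in> carrier_mat r m" for L :: "'a mat"
  proof -
    have nL: "- L \<in> carrier_mat r m" using L by simp
    have "shear_mat L * shear_mat (- L) = four_block_mat (1\<^sub>m m) (0\<^sub>m m r) (L + - L) (1\<^sub>m r)"
      unfolding shear_mat_def using L nL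
      by (subst mult_four_block_mat[of _ m m _ r _ r _ _ m _ r]) auto
    also have "L + - L = 0\<^sub>m r m" using L by (intro eq_matI) auto
    finally show ?thesis by simp
  qed
  show "shear_mat L * shear_mat (- L) = 1\<^sub>m (m + r)" by (rule inv[OF L])
  show "shear_mat (- L) * shear_mat L = 1\<^sub>m (m + r)" using inv[of "- L"] L by simp
qed

lemma shear_mat_mult_vec:
  fixes L :: "'a :: comm_ring_1 mat"
  assumes L: "L \<in> carrier_mat r m" and v: "v \<in> carrier_vec m" and w: "w \<in> carrier_vec r"
  shows "shear_mat L *\<^sub>v (v @\<^sub>v w) = v @\<^sub>v (L *\<^sub>v v + w)"
  unfolding shear_mat_def using L v w
  by (subst four_block_mat_mult_vec[of _ m m _ r _ r]) auto

lemma char_poly_block_triangular: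
  fixes a b d :: "'a :: idom mat"
  assumes a: "a \<in> carrier_mat m m" and b: "b \<in> carrier_mat m r" and d: "d \<in> carrier_mat r r"
  shows "char_poly (four_block_mat a b (0\<^sub>m r m) d) = char_poly a * char_poly d"
proof -
  have "char_poly_matrix (four_block_mat a b (0\<^sub>m r m) d) =
      four_block_mat (char_poly_matrix a) (map_mat (\<lambda>x. [:- x:]) b) (0\<^sub>m r m) (char_poly_matrix d)"
    using a b d by (intro eq_matI) (auto simp: char_poly_matrix_def)
  then show ?thesis
    unfolding char_poly_def
    using a b d by (simp add: det_four_block_mat_lower_left_zero[of _ m _ r])
qed

text \<open>The assumption says that the subspace of all \<open>(v, L v)\<close> is mapped into itself by the block matrix.
Then \<open>A1\<close> below is the induced map on this subspace and \<open>D\<close> the induced map on the quotient by it.\<close>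

locale invariant_graph =
  fixes m r :: nat and a b c d L :: "'a :: comm_ring_1 mat"
  assumes a: "a \<in> carrier_mat m m" and b: "b \<in> carrier_mat m r"
    and c: "c \<in> carrier_mat r m" and d: "d \<in> carrier_mat r r" and L: "L \<in> carrier_mat r m"
    and invariant: "c + d * L = L * (a + b * L)"
begin

abbreviation "A \<equiv> four_block_mat a b c d"
abbreviation "A1 \<equiv> a + b * L"
abbreviation "D \<equiv> d - L * b"
abbreviation "B \<equiv> four_block_mat A1 b (0\<^sub>m r m) D"

lemma carriers: "A1 \<in> carrier_mat m m" "D \<in> carrier_mat r r"
  "A \<in> carrier_mat (m + r) (m + r)" "B \<in> carrier_mat (m + r) (m + r)"
  using a b c d L by auto

lemma intertwine: "A * shear_mat L = shear_mat L * B"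
proof -
  have "A * shear_mat L = four_block_mat A1 b (c + d * L) d"
    unfolding shear_mat_def using a b c d L
    by (subst mult_four_block_mat[of _ m m _ r _ r _ _ m _ r]) auto
  also have "\<dots> = four_block_mat A1 b (L * A1) (L * b + D)"
  proof -
    have "d = L * b + D" using b d L by (intro eq_matI) auto
    then show ?thesis unfolding invariant by (rule arg_cong)
  qed
  also have "\<dots> = shear_mat L * B"
    unfolding shear_mat_def using b L carriers
    by (subst mult_four_block_mat[of _ m m _ r _ r _ _ m _ r]) auto
  finally show ?thesis .
qed

lemma similar: "similar_mat A B"
proof (rule similar_matI)
  have P: "shear_mat L \<in> carrier_mat (m + r) (m + r)" and Q: "shear_mat (- L) \<in> carrier_mat (m + r) (m + r)"
    using L by auto
  show "{A, B, shear_mat L, shear_mat (- L)} \<subseteq> carrier_mat (m + r) (m + r)"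
    using carriers P Q by blast
  show "shear_mat L * shear_mat (- L) = 1\<^sub>m (m + r)" "shear_mat (- L) * shear_mat L = 1\<^sub>m (m + r)"
    by (rule shear_mat_inverse[OF L])+
  have "A = A * (shear_mat L * shear_mat (- L))"
    unfolding shear_mat_inverse[OF L] using carriers by (intro right_mult_one_mat[symmetric])
  also have "\<dots> = shear_mat L * B * shear_mat (- L)"
    using assoc_mult_mat[OF carriers(3) P Q] by (simp add: intertwine)
  finally show "A = shear_mat L * B * shear_mat (- L)" .
qed

text \<open>In shear coordinates the second component evolves by \<open>D\<close> alone, because the matrix \<open>B\<close> is block
triangular; the first component \<open>u\<close> need not be known.\<close>

lemma trajectory_form:
  assumes traj: "trajectory A x" and w: "w \<in> carrier_vec r"
    and v: "v \<in> carrier_vec m" and x0: "x 0 = v @\<^sub>v (L *\<^sub>v v + w)"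
  shows "\<exists>u \<in> carrier_vec m. x t = u @\<^sub>v (L *\<^sub>v u + D ^\<^sub>m t *\<^sub>v w)"
proof (induction t)
  case 0
  have "D ^\<^sub>m 0 *\<^sub>v w = w" using L w by simp
  then show ?case using x0 v by metis
next
  case (Suc t)
  then obtain u where u: "u \<in> carrier_vec m" and xt: "x t = u @\<^sub>v (L *\<^sub>v u + D ^\<^sub>m t *\<^sub>v w)" by blast
  define y where "y = D ^\<^sub>m t *\<^sub>v w"
  define u' where "u' = A1 *\<^sub>v u + b *\<^sub>v y"
  have Dt: "D ^\<^sub>m t \<in> carrier_mat r r" using pow_carrier_mat[OF carriers(2)] .
  have y: "y \<in> carrier_vec r" unfolding y_def using Dt w by simp
  have u': "u' \<in> carrier_vec m" unfolding u'_def
    by (intro add_carrier_vec mult_mat_vec_carrier[OF carriers(1) u] mult_mat_vec_carrier[OF b y])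
  have uy: "u @\<^sub>v y \<in> carrier_vec (m + r)" using u y by simp
  have P: "shear_mat L \<in> carrier_mat (m + r) (m + r)" using L by simp
  have Dy: "D *\<^sub>v y = D ^\<^sub>m Suc t *\<^sub>v w"
  proof -
    have "D ^\<^sub>m (1 + t) = D ^\<^sub>m 1 * D ^\<^sub>m t" by (rule pow_mat_add[OF carriers(2)])
    also have "D ^\<^sub>m 1 = D" using left_mult_one_mat[OF carriers(2)] carriers(2) by simp
    finally have "D ^\<^sub>m Suc t = D * D ^\<^sub>m t" by (simp only: plus_1_eq_Suc)
    then show ?thesis unfolding y_def using assoc_mult_mat_vec[OF carriers(2) Dt w] by (simp only:)
  qed
  have Dy_carrier: "D *\<^sub>v y \<in> carrier_vec r" by (rule mult_mat_vec_carrier[OF carriers(2) y])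
  have "x (Suc t) = A *\<^sub>v x t" using traj by (simp only: trajectory_def)
  also have "x t = shear_mat L *\<^sub>v (u @\<^sub>v y)"
    using xt shear_mat_mult_vec[OF L u y] by (simp only: y_def)
  also have "A *\<^sub>v \<dots> = shear_mat L *\<^sub>v (B *\<^sub>v (u @\<^sub>v y))"
    using assoc_mult_mat_vec[OF carriers(3) P uy] assoc_mult_mat_vec[OF P carriers(4) uy]
    by (simp only: intertwine)
  also have "B *\<^sub>v (u @\<^sub>v y) = u' @\<^sub>v (0\<^sub>m r m *\<^sub>v u + D *\<^sub>v y)"
    unfolding u'_def by (rule four_block_mat_mult_vec[OF carriers(1) b zero_carrier_mat carriers(2) u y])
  also have "0\<^sub>m r m *\<^sub>v u = 0\<^sub>v r" using u by (intro eq_vecI) auto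
  also have "0\<^sub>v r + D *\<^sub>v y = D *\<^sub>v y" by (rule left_zero_vec[OF Dy_carrier])
  also have "shear_mat L *\<^sub>v (u' @\<^sub>v D *\<^sub>v y) = u' @\<^sub>v (L *\<^sub>v u' + D ^\<^sub>m Suc t *\<^sub>v w)"
    unfolding Dy[symmetric] by (rule shear_mat_mult_vec[OF L u' Dy_carrier])
  finally show ?case using u' by blast
qed

end

section \<open>Synchronization as nilpotency of the deviation dynamics\<close>

text \<open>The unit vectors are enough to test the invariance: the image of \<open>(e, L e)\<close> is
\<open>((a + b L) e, (c + d L) e)\<close>, and this lies in the graph of \<open>L\<close> only if its lower part is \<open>L\<close>
applied to its upper part.\<close>

lemma sync_set_invariant_blocks:
  fixes a b c d :: "'a :: comm_ring_1 mat"
  assumes n: "n > 0" and m: "m > 0"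
    and a: "a \<in> carrier_mat m m" and b: "b \<in> carrier_mat m (n * m - m)"
    and c: "c \<in> carrier_mat (n * m - m) m" and d: "d \<in> carrier_mat (n * m - m) (n * m - m)"
    and inv: "(\<lambda>v. four_block_mat a b c d *\<^sub>v v) ` sync_set n m \<subseteq> sync_set n m"
  defines "L \<equiv> copies_mat (n * m - m) m"
  shows "c + d * L = L * (a + b * L)"
proof (rule eq_mat_if_unit_vecs)
  let ?r = "n * m - m"
  have L: "L \<in> carrier_mat ?r m" by (simp add: L_def)
  have bL: "b * L \<in> carrier_mat m m" and dL: "d * L \<in> carrier_mat ?r m"
    using mult_carrier_mat[OF b L] mult_carrier_mat[OF d L] by auto
  show "c + d * L \<in> carrier_mat ?r m" by (rule add_carrier_mat[OF dL])
  show "L * (a + b * L) \<in> carrier_mat ?r m" by (rule mult_carrier_mat[OF L add_carrier_mat[OF bL]])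
  fix j assume "j < m"
  define e :: "'a vec" where "e = unit_vec m j"
  have e: "e \<in> carrier_vec m" and Le: "L *\<^sub>v e \<in> carrier_vec ?r" using L by (auto simp: e_def)
  have top: "(a + b * L) *\<^sub>v e = a *\<^sub>v e + b *\<^sub>v (L *\<^sub>v e)"
    using add_mult_distrib_mat_vec[OF a bL e] assoc_mult_mat_vec[OF b L e] by simp
  have bot: "(c + d * L) *\<^sub>v e = c *\<^sub>v e + d *\<^sub>v (L *\<^sub>v e)"
    using add_mult_distrib_mat_vec[OF c dL e] assoc_mult_mat_vec[OF d L e] by simp
  have sync: "sync_set n m = {\<alpha> @\<^sub>v (L *\<^sub>v \<alpha>) | \<alpha>. \<alpha> \<in> carrier_vec m}"
    unfolding sync_set_def L_def using sync_vec_eq_append[OF n m] by (metis (no_types, lifting))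
  have "four_block_mat a b c d *\<^sub>v (e @\<^sub>v (L *\<^sub>v e)) \<in> sync_set n m"
    using inv e unfolding sync by blast
  also have "four_block_mat a b c d *\<^sub>v (e @\<^sub>v (L *\<^sub>v e)) =
      (a + b * L) *\<^sub>v e @\<^sub>v (c + d * L) *\<^sub>v e"
    unfolding top bot by (rule four_block_mat_mult_vec[OF a b c d e Le])
  finally obtain \<beta> where \<beta>: "\<beta> \<in> carrier_vec m"
    and eq: "(a + b * L) *\<^sub>v e @\<^sub>v (c + d * L) *\<^sub>v e = \<beta> @\<^sub>v (L *\<^sub>v \<beta>)"
    unfolding sync by blast
  have "(a + b * L) *\<^sub>v e \<in> carrier_vec m"
    by (rule mult_mat_vec_carrier[OF add_carrier_mat[OF bL] e])
  from eq[unfolded append_vec_eq[OF this \<beta>]]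
  have "(c + d * L) *\<^sub>v e = L *\<^sub>v ((a + b * L) *\<^sub>v e)" by simp
  then show "(c + d * L) *\<^sub>v unit_vec m j = L * (a + b * L) *\<^sub>v unit_vec m j"
    unfolding e_def[symmetric] using assoc_mult_mat_vec[OF L add_carrier_mat[OF bL] e] by simp
qed

text \<open>Any deviation \<open>w\<close> occurs at time 0 of some trajectory, so synchronization from all initial states
amounts to the extinction of all deviations under iteration of \<open>D\<close>.\<close>

lemma (in invariant_graph) synchronization_iff_difference_dies:
  assumes n: "n > 0" and m: "m > 0" and r: "r = n * m - m" and copies: "L = copies_mat r m"
  shows "achieves_synchronization n m A \<longleftrightarrow>
    (\<forall>w \<in> carrier_vec r. \<exists>T. \<forall>t\<ge>T. D ^\<^sub>m t *\<^sub>v w = 0\<^sub>v r)" (is "?sync \<longleftrightarrow> ?dies")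
proof -
  have nm: "n * m = m + r" using n r by (cases n) auto
  have agree: "(\<forall>i<n. \<forall>j<n. agent_state m (x t) i = agent_state m (x t) j) \<longleftrightarrow>
      D ^\<^sub>m t *\<^sub>v w = 0\<^sub>v r"
    if traj: "trajectory A x" and w: "w \<in> carrier_vec r"
      and v: "v \<in> carrier_vec m" and x0: "x 0 = v @\<^sub>v (L *\<^sub>v v + w)" for x v w t
  proof -
    obtain u where u: "u \<in> carrier_vec m" and xt: "x t = u @\<^sub>v (L *\<^sub>v u + D ^\<^sub>m t *\<^sub>v w)"
      using trajectory_form[OF traj w v x0] by blast
    have "D ^\<^sub>m t *\<^sub>v w \<in> carrier_vec (n * m - m)"
      using mult_mat_vec_carrier[OF pow_carrier_mat[OF carriers(2)] w] unfolding r .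
    from agents_agree_iff[OF m u this] show ?thesis unfolding xt by (simp only: copies r)
  qed
  show ?thesis
  proof
    assume sync: ?sync
    show ?dies
    proof
      fix w :: "'a vec" assume w: "w \<in> carrier_vec r"
      define x where "x t = ((\<lambda>v. A *\<^sub>v v) ^^ t) (0\<^sub>v m @\<^sub>v (L *\<^sub>v 0\<^sub>v m + w))" for t
      have traj: "trajectory A x" by (simp add: trajectory_def x_def)
      have x0: "x 0 = 0\<^sub>v m @\<^sub>v (L *\<^sub>v 0\<^sub>v m + w)" by (simp add: x_def)
      have "x 0 \<in> carrier_vec (n * m)" unfolding x0 nm
        by (intro append_carrier_vec zero_carrier_vec add_carrier_vec w
            mult_mat_vec_carrier[OF L])
      then obtain T where "\<forall>t\<ge>T. \<forall>i<n. \<forall>j<n. agent_state m (x t) i = agent_state m (x t) j"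
        using sync traj unfolding achieves_synchronization_def by blast
      then show "\<exists>T. \<forall>t\<ge>T. D ^\<^sub>m t *\<^sub>v w = 0\<^sub>v r"
        unfolding agree[OF traj w zero_carrier_vec x0] by (rule exI)
    qed
  next
    assume dies: ?dies
    show ?sync unfolding achieves_synchronization_def
    proof (intro allI impI)
      fix x assume "x 0 \<in> carrier_vec (n * m) \<and> trajectory A x"
      then have x0: "x 0 \<in> carrier_vec (m + r)" and traj: "trajectory A x" using nm by auto
      define v where "v = vec_first (x 0) m"
      define w where "w = vec_last (x 0) r - L *\<^sub>v v"
      have v: "v \<in> carrier_vec m" by (simp add: v_def)
      have Lv: "L *\<^sub>v v \<in> carrier_vec r" by (rule mult_mat_vec_carrier[OF L v])
      have w: "w \<in> carrier_vec r" unfolding w_def using Lv by simp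
      have "L *\<^sub>v v + w = vec_last (x 0) r"
        unfolding w_def using L by (intro eq_vecI) auto
      then have split: "x 0 = v @\<^sub>v (L *\<^sub>v v + w)"
        using vec_first_last_append[OF x0] by (simp add: v_def)
      obtain T where "\<forall>t\<ge>T. D ^\<^sub>m t *\<^sub>v w = 0\<^sub>v r" using bspec[OF dies w] by (elim exE)
      then have "\<forall>t\<ge>Suc T. \<forall>i<n. \<forall>j<n. agent_state m (x t) i = agent_state m (x t) j"
        unfolding agree[OF traj w v split] using Suc_leD by simp
      then show "\<exists>T>0. \<forall>t\<ge>T. \<forall>i<n. \<forall>j<n. agent_state m (x t) i = agent_state m (x t) j"
        by (intro exI[of _ "Suc T"] conjI zero_less_Suc)
    qed
  qed
qed

theorem theorem3p1:
  fixes A :: "'p :: prime_card mod_ring mat" and n m :: nat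
  assumes "n > 0" and "m > 0"
    and "A \<in> carrier_mat (n * m) (n * m)"
    and "(\<lambda>v. A *\<^sub>v v) ` sync_set n m \<subseteq> sync_set n m"
  shows "achieves_synchronization n m A \<longleftrightarrow>
    char_poly A = Polynomial.monom 1 (n * m - m) * char_poly (first_block_row_sum n m A)"
proof -
  define r where "r = n * m - m"
  define L where "L = (copies_mat r m :: 'p mod_ring mat)"
  have nm: "n * m = m + r" using \<open>n > 0\<close> by (cases n) (auto simp: r_def)
  obtain a b c d where split: "split_block A m m = (a, b, c, d)" by (cases "split_block A m m")
  have dims: "dim_row A = m + r" "dim_col A = m + r" using assms(3) nm by auto
  note blocks = split_block[OF split dims]
  have L: "L \<in> carrier_mat r m" by (simp add: L_def)
  have "c + d * L = L * (a + b * L)"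
    unfolding L_def r_def
    by (rule sync_set_invariant_blocks[OF assms(1,2)])
      (use blocks assms(4) in \<open>simp_all add: r_def\<close>)
  then have graph: "invariant_graph m r a b c d L"
    using blocks L by unfold_locales
  interpret G: invariant_graph m r a b c d L by (rule graph)
  have row_sum: "first_block_row_sum n m A = a + b * L"
    unfolding blocks(5) L_def r_def
    by (rule first_block_row_sum_eq[OF assms(1)]) (use blocks in \<open>simp_all add: r_def\<close>)
  have char: "char_poly A = char_poly (a + b * L) * char_poly (d - L * b)"
    using char_poly_similar[OF G.similar] char_poly_block_triangular[OF G.carriers(1) G.b G.carriers(2)]
    unfolding blocks(5)[symmetric] by simp
  have nonzero: "char_poly (a + b * L) \<noteq> 0"
    using degree_monic_char_poly[OF G.carriers(1)] by auto
  have "achieves_synchronization n m A \<longleftrightarrow>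
      (\<forall>w \<in> carrier_vec r. \<exists>T. \<forall>t\<ge>T. (d - L * b) ^\<^sub>m t *\<^sub>v w = 0\<^sub>v r)"
    using G.synchronization_iff_difference_dies[OF assms(1,2) r_def L_def] blocks(5) by simp
  also have "\<dots> \<longleftrightarrow> (\<exists>k. (d - L * b) ^\<^sub>m k = 0\<^sub>m r r)"
    by (rule nilpotent_iff_pointwise[OF G.carriers(2), symmetric])
  also have "\<dots> \<longleftrightarrow> char_poly (d - L * b) = Polynomial.monom 1 r"
    using char_poly_nilpotent[OF G.carriers(2)] nilpotent_if_char_poly_monom[OF G.carriers(2)] by blast
  also have "\<dots> \<longleftrightarrow> char_poly A = Polynomial.monom 1 (n * m - m) * char_poly (first_block_row_sum n m A)"
    unfolding char row_sum r_def[symmetric] using nonzero by (simp add: mult.commute)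
  finally show ?thesis .
qed

end
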